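(* Linearithmic--time bounded--error 1-way unary PTMs can recognize uncountably many languages in $O(\log n)$ space.
   Context: A one--way PTM is a probabilistic Turing machine (arbitrary real transition probabilities) with a read--only input tape, holding the input between a left end-marker and a right end-marker (the dollar sign \$), whose head never moves left, and a two--way work tape; space is the maximum number of work-tape cells visited, $n$ is the input length. Unary means a single-letter input alphabet. Bounded-error recognition: members accepted with probability at least $1-\epsilon$, non-members with probability at most $\epsilon$, for some $\epsilon<1/2$. Linearithmic time means $O(n\log n)$. *)

theory Defs
  imports "HOL-Probability.Probability" "HOL-Library.Extended_Nat" "HOL-Library.Landau_Symbols"
begin

datatype move = MLeft | MStay | MRight

datatype 'a tape_symbol = LeftEnd | Letter 'a | Dollar

text \<open>
  A transition reads the current state, the scanned input symbol and the scanned work symbol, and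
  yields a distribution on (new state, written work symbol, input head move, work head move). The
  probabilities are arbitrary reals. The type \<open>'a\<close> is the input alphabet.
\<close>

record ('q, 'g, 'a) ptm =
  states :: "'q set"
  symbols :: "'g set"
  blank :: 'g
  start :: 'q
  acc :: 'q
  rej :: 'q
  trans :: "'q \<Rightarrow> 'a tape_symbol \<Rightarrow> 'g \<Rightarrow> ('q \<times> 'g \<times> move \<times> move) pmf"

definition halting :: "('q, 'g, 'a) ptm \<Rightarrow> 'q \<Rightarrow> bool" where
  "halting M q \<longleftrightarrow> q = acc M \<or> q = rej M"

text \<open>The input head may not leave the part of the input tape delimited by the end-markers.\<close>

definition is_ptm :: "('q, 'g, 'a) ptm \<Rightarrow> bool" where
  "is_ptm M \<longleftrightarrow>
     finite (states M) \<and> finite (symbols M) \<and> blank M \<in> symbols M \<and>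
     start M \<in> states M \<and> acc M \<in> states M \<and> rej M \<in> states M \<and> acc M \<noteq> rej M \<and>
     (\<forall>q \<in> states M. \<forall>a. \<forall>g \<in> symbols M. \<not> halting M q \<longrightarrow>
        (\<forall>(q', g', d, e) \<in> set_pmf (trans M q a g).
           q' \<in> states M \<and> g' \<in> symbols M \<and>
           (a = LeftEnd \<longrightarrow> d \<noteq> MLeft) \<and> (a = Dollar \<longrightarrow> d \<noteq> MRight)))"

definition one_way :: "('q, 'g, 'a) ptm \<Rightarrow> bool" where
  "one_way M \<longleftrightarrow>
     (\<forall>q \<in> states M. \<forall>a. \<forall>g \<in> symbols M. \<not> halting M q \<longrightarrow>
        (\<forall>(q', g', d, e) \<in> set_pmf (trans M q a g). d \<noteq> MLeft))"

text \<open>The work tape is infinite in both directions, with cells indexed by the integers.\<close>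

record ('q, 'g) config =
  cstate :: 'q
  ihead :: nat
  whead :: int
  wtape :: "int \<Rightarrow> 'g"

definition input_at :: "'a list \<Rightarrow> nat \<Rightarrow> 'a tape_symbol" where
  "input_at w p =
     (if p = 0 then LeftEnd else if p \<le> length w then Letter (w ! (p - 1)) else Dollar)"

fun move_input :: "move \<Rightarrow> nat \<Rightarrow> nat" where
  "move_input MLeft p = p - 1"
| "move_input MStay p = p"
| "move_input MRight p = p + 1"

fun move_work :: "move \<Rightarrow> int \<Rightarrow> int" where
  "move_work MLeft p = p - 1"
| "move_work MStay p = p"
| "move_work MRight p = p + 1"

definition initial :: "('q, 'g, 'a) ptm \<Rightarrow> ('q, 'g) config" where
  "initial M = \<lparr>cstate = start M, ihead = 0, whead = 0, wtape = (\<lambda>_. blank M)\<rparr>"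

definition apply_action ::
    "('q, 'g) config \<Rightarrow> 'q \<times> 'g \<times> move \<times> move \<Rightarrow> ('q, 'g) config" where
  "apply_action c = (\<lambda>(q, g, d, e).
     \<lparr>cstate = q, ihead = move_input d (ihead c), whead = move_work e (whead c),
      wtape = (wtape c)(whead c := g)\<rparr>)"

definition step ::
    "('q, 'g, 'a) ptm \<Rightarrow> 'a list \<Rightarrow> ('q, 'g) config \<Rightarrow> ('q, 'g) config pmf" where
  "step M w c =
     (if halting M (cstate c) then return_pmf c
      else map_pmf (apply_action c)
             (trans M (cstate c) (input_at w (ihead c)) (wtape c (whead c))))"

primrec run :: "('q, 'g, 'a) ptm \<Rightarrow> 'a list \<Rightarrow> nat \<Rightarrow> ('q, 'g) config pmf" where
  "run M w 0 = return_pmf (initial M)"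
| "run M w (Suc t) = bind_pmf (run M w t) (step M w)"

text \<open>
  Halting configurations are absorbing, so the probability of having accepted within \<open>t\<close> steps
  is nondecreasing in \<open>t\<close> and the supremum is its limit.
\<close>

definition accept_prob :: "('q, 'g, 'a) ptm \<Rightarrow> 'a list \<Rightarrow> real" where
  "accept_prob M w = (SUP t. measure_pmf.prob (run M w t) {c. cstate c = acc M})"

definition recognizes_bounded_error :: "('q, 'g, 'a) ptm \<Rightarrow> 'a list set \<Rightarrow> bool" where
  "recognizes_bounded_error M L \<longleftrightarrow>
     (\<exists>\<epsilon>::real. 0 \<le> \<epsilon> \<and> \<epsilon> < 1/2 \<and>
        (\<forall>w. w \<in> L \<longrightarrow> accept_prob M w \<ge> 1 - \<epsilon>) \<and>
        (\<forall>w. w \<notin> L \<longrightarrow> accept_prob M w \<le> \<epsilon>))"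

text \<open>
  The finite computation paths of nonzero probability, as nonempty lists of configurations; a path
  is not continued after a halting configuration.
\<close>

inductive computation ::
    "('q, 'g, 'a) ptm \<Rightarrow> 'a list \<Rightarrow> ('q, 'g) config list \<Rightarrow> bool" for M w where
  init: "computation M w [initial M]"
| step: "computation M w cs \<Longrightarrow> \<not> halting M (cstate (last cs)) \<Longrightarrow>
     c \<in> set_pmf (step M w (last cs)) \<Longrightarrow> computation M w (cs @ [c])"

text \<open>
  Worst-case time; it is infinite if the lengths of the paths are unbounded, in particular if some
  path can be continued forever without halting.
\<close>

definition time_on :: "('q, 'g, 'a) ptm \<Rightarrow> 'a list \<Rightarrow> enat" where
  "time_on M w = (SUP cs \<in> {cs. computation M w cs}. enat (length cs - 1))"

definition space_on :: "('q, 'g, 'a) ptm \<Rightarrow> 'a list \<Rightarrow> enat" where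
  "space_on M w = (SUP cs \<in> {cs. computation M w cs}. enat (card (whead ` set cs)))"

definition runs_in_time :: "('q, 'g, 'a) ptm \<Rightarrow> (nat \<Rightarrow> real) \<Rightarrow> bool" where
  "runs_in_time M f \<longleftrightarrow>
     (\<exists>T :: nat \<Rightarrow> nat. (\<lambda>n. real (T n)) \<in> O(f) \<and> (\<forall>w. time_on M w \<le> enat (T (length w))))"

definition runs_in_space :: "('q, 'g, 'a) ptm \<Rightarrow> (nat \<Rightarrow> real) \<Rightarrow> bool" where
  "runs_in_space M f \<longleftrightarrow>
     (\<exists>S :: nat \<Rightarrow> nat. (\<lambda>n. real (S n)) \<in> O(f) \<and> (\<forall>w. space_on M w \<le> enat (S (length w))))"

end

theory Submission
  imports Defs "HOL-Probability.Hoeffding" "HOL-Library.Log_Nat"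
begin

text \<open>
  While reading the input, the machine tosses a coin of bias \<open>p\<close> per letter and keeps two counters
  side by side on the work tape: the number of letters read, in bijective base 16 (digits 1 to 16),
  and the number \<open>h\<close> of heads, in base 4. The words that matter have length
  \<open>n = 1 + 16 + \<dots> + 16^(k-1) = (16^k - 1) / 15\<close>, which is recognised by the first counter
  reading \<open>1\<dots>1\<close>; this also puts the head on cell \<open>k\<close>, that is, on the digit of \<open>h\<close> of weight
  \<open>4^k\<close>. With \<open>p = 15 q\<close> the expected value of \<open>h / 4^k\<close> is \<open>q 4^k - q 4^(-k)\<close>, while its standard
  deviation is below \<open>1/7\<close>, so this digit reveals the \<open>k\<close>-th base-4 digit of \<open>q\<close>, provided that the
  digits of \<open>q\<close> are only 0 and 2. The digits of \<open>q\<close> encode an arbitrary set of numbers \<open>k \<ge> 3\<close>.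
\<close>

section \<open>Time, space and acceptance probability by induction\<close>

text \<open>
  A certificate that from \<open>c\<close> every path halts within \<open>t\<close> steps, keeps the work head in \<open>S\<close>, and
  that the acceptance probability is \<open>a\<close>.
\<close>

inductive halts_with ::
    "('q, 'g, 'a) ptm \<Rightarrow> 'a list \<Rightarrow> int set \<Rightarrow> nat \<Rightarrow> ('q, 'g) config \<Rightarrow> real \<Rightarrow> bool"
  for M w S where
  halt: "halting M (cstate c) \<Longrightarrow> whead c \<in> S \<Longrightarrow>
    halts_with M w S t c (of_bool (cstate c = acc M))"
| step: "\<not> halting M (cstate c) \<Longrightarrow> whead c \<in> S \<Longrightarrow>
    (\<And>c'. c' \<in> set_pmf (step M w c) \<Longrightarrow> halts_with M w S t c' (f c')) \<Longrightarrow>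
    halts_with M w S (Suc t) c (measure_pmf.expectation (step M w c) f)"

lemma halts_with_head: "halts_with M w S t c a \<Longrightarrow> whead c \<in> S"
  by (induction rule: halts_with.induct) auto

lemma halts_with_mono: "halts_with M w S t c a \<Longrightarrow> t \<le> t' \<Longrightarrow> halts_with M w S t' c a"
proof (induction arbitrary: t' rule: halts_with.induct)
  case (halt c t)
  then show ?case by (rule_tac halts_with.halt)
next
  case (step c t f)
  then obtain u where "t' = Suc u" "t \<le> u" by (cases t') auto
  then show ?case using step by (auto intro!: halts_with.step)
qed

lemma halts_with_det:
  assumes "step M w c = return_pmf c'" "\<not> halting M (cstate c)" "whead c \<in> S"
    "halts_with M w S t c' a"
  shows "halts_with M w S (Suc t) c a"
  using halts_with.step[of M c S w t "\<lambda>_. a"] assms by simp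

lemma halts_with_branch:
  assumes "step M w c = map_pmf g (bernoulli_pmf p)" "inj g" "0 \<le> p" "p \<le> 1"
    "\<not> halting M (cstate c)" "whead c \<in> S" "\<And>b. halts_with M w S t (g b) (a b)"
  shows "halts_with M w S (Suc t) c (p * a True + (1 - p) * a False)"
proof -
  \<comment> \<open>The value has to be a function of the successor configuration; as
    \<open>g\<close> is injective, \<open>inv g\<close> recovers the outcome of the coin from
    it.\<close>
  have "halts_with M w S (Suc t) c (measure_pmf.expectation (step M w c) (a \<circ> inv g))"
    using assms by (intro halts_with.step) (auto simp: inv_f_f)
  then show ?thesis using assms by (simp add: inv_f_f algebra_simps)
qed

text \<open>Invariant along a path: the steps already made plus the budget of the last configuration
  never exceed \<open>T\<close>.\<close>

lemma computation_halts_with: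
  assumes "halts_with M w S T (initial M) a" "computation M w cs"
  shows "cs \<noteq> [] \<and> whead ` set cs \<subseteq> S \<and>
    (\<exists>t b. halts_with M w S t (last cs) b \<and> length cs - 1 + t \<le> T)"
  using assms(2)
proof (induction rule: computation.induct)
  case init
  then show ?case using assms(1) halts_with_head[OF assms(1)] by auto
next
  case (step cs c)
  then obtain t b where t: "halts_with M w S t (last cs) b" "length cs - 1 + t \<le> T" by auto
  \<comment> \<open>Only rule \<open>step\<close> can certify a configuration that has not halted,
    so the budget is a successor and drops by one.\<close>
  from t(1) step.hyps(2,3) obtain t' b' where "t = Suc t'" "halts_with M w S t' c b'"
    by (cases rule: halts_with.cases) auto
  moreover have "length cs \<ge> 1" using step.IH by (cases cs) auto
  ultimately show ?case using step.IH t(2) halts_with_head[of M w S t' c b']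
    by (auto intro!: exI[of _ t'])
qed

lemma time_on_le: "halts_with M w S T (initial M) a \<Longrightarrow> time_on M w \<le> enat T"
  unfolding time_on_def by (rule SUP_least) (auto dest!: computation_halts_with)

lemma space_on_le:
  "halts_with M w S T (initial M) a \<Longrightarrow> finite S \<Longrightarrow> space_on M w \<le> enat (card S)"
  unfolding space_on_def by (rule SUP_least) (auto dest!: computation_halts_with intro: card_mono)

text \<open>Unfolds the first step, as \<open>halts_with\<close> does, whereas \<open>run\<close>
  unfolds the last one.\<close>

primrec accept_within ::
    "('q, 'g, 'a) ptm \<Rightarrow> 'a list \<Rightarrow> nat \<Rightarrow> ('q, 'g) config \<Rightarrow> real" where
  "accept_within M w 0 c = of_bool (cstate c = acc M)"
| "accept_within M w (Suc t) c = measure_pmf.expectation (step M w c) (accept_within M w t)"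

lemma accept_within_bounds: "0 \<le> accept_within M w t c \<and> accept_within M w t c \<le> 1"
proof (induction t arbitrary: c)
  case (Suc t)
  have "integrable (measure_pmf (step M w c)) (accept_within M w t)"
    using Suc by (intro measure_pmf.integrable_const_bound[where B=1]) auto
  then show ?case using Suc
    by (auto intro!: integral_nonneg_AE measure_pmf.integral_le_const)
qed auto

lemma expectation_bind_pmf:
  fixes f :: "'b \<Rightarrow> real"
  assumes "\<And>x. 0 \<le> f x \<and> f x \<le> 1"
  shows "measure_pmf.expectation (bind_pmf p q) f =
    measure_pmf.expectation p (\<lambda>x. measure_pmf.expectation (q x) f)"
  unfolding measure_pmf_bind using assms
  by (intro integral_bind[where K="count_space UNIV" and B=1 and B'=1]) 
    (auto simp: measure_pmf.emeasure_space_1 measure_pmf_in_subprob_algebra)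

text \<open>Each induction step hands one step of the computation over from
  \<open>accept_within\<close> to \<open>run\<close>. With \<open>s = 0\<close> this links the two
  views; \<open>t = 0\<close> and \<open>t = 1\<close> compare consecutive times.\<close>

lemma prob_run_add:
  "measure_pmf.prob (run M w (s + t)) {c. cstate c = acc M} =
   measure_pmf.expectation (run M w s) (accept_within M w t)"
proof (induction t arbitrary: s)
  case 0
  have "accept_within M w 0 = indicator {c. cstate c = acc M}"
    by (auto simp: fun_eq_iff)
  then show ?case by simp
next
  case (Suc t)
  then show ?case
    using Suc[of "Suc s"]
    by (simp add: expectation_bind_pmf[OF accept_within_bounds])
qed

lemma accept_within_halting:
  "halting M (cstate c) \<Longrightarrow> accept_within M w t c = of_bool (cstate c = acc M)"
  by (induction t) (auto simp: step_def)

lemma halts_with_accept_within: "halts_with M w S t c a \<Longrightarrow> accept_within M w t c = a"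
proof (induction rule: halts_with.induct)
  case (step c t f)
  then show ?case by (auto intro!: integral_cong_AE simp: AE_measure_pmf_iff)
qed (rule accept_within_halting)

text \<open>The acceptance probabilities are nondecreasing in time and equal \<open>a\<close> from
  \<open>T\<close> on, so their supremum is the maximum \<open>a\<close>.\<close>

lemma accept_prob_eq:
  assumes "halts_with M w S T (initial M) a"
  shows "accept_prob M w = a"
proof -
  let ?P = "\<lambda>t. measure_pmf.prob (run M w t) {c. cstate c = acc M}"
  have eq: "?P t = a" if "t \<ge> T" for t
    using prob_run_add[of M w 0 t] halts_with_accept_within[OF halts_with_mono[OF assms that]]
    by simp
  have "?P t \<le> ?P (Suc t)" for t
  proof -
    have "?P t = measure_pmf.expectation (run M w t) (accept_within M w 0)"
      using prob_run_add[of M w t 0] by simp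
    \<comment> \<open>Monotonicity holds because an accepting configuration is absorbing.\<close>
    also have "\<dots> \<le> measure_pmf.expectation (run M w t) (accept_within M w 1)"
    proof (intro integral_mono measure_pmf.integrable_const_bound[where B=1] AE_I2)
      show "accept_within M w 0 c \<le> accept_within M w 1 c" for c
        using accept_within_halting[of M c w 1] accept_within_bounds[of M w 1 c]
        by (cases "cstate c = acc M") (simp_all add: halting_def)
    qed (use accept_within_bounds[of M w] in \<open>auto simp del: accept_within.simps\<close>)
    also have "\<dots> = ?P (Suc t)"
      using prob_run_add[of M w t 1] by simp
    finally show ?thesis .
  qed
  then have "mono ?P" by (rule mono_iff_le_Suc[THEN iffD2, rule_format])
  then have le: "?P t \<le> a" for t
    using eq[of "max t T"] monoD[of ?P t "max t T"] by simp
  show ?thesis unfolding accept_prob_def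
    using eq[of T] le by (intro cSup_eq_maximum) auto
qed

section \<open>The two counters\<close>

text \<open>
  A cell holds a pair of a bijective base-16 digit, where 0 only occurs above the most significant
  digit, and a base-4 digit; cells are listed from the least significant one. The counters are
  incremented by \<open>c\<close> and \<open>b\<close>, which also act as the incoming carries.
\<close>

fun increment :: "nat \<Rightarrow> nat \<Rightarrow> (nat \<times> nat) list \<Rightarrow> (nat \<times> nat) list" where
  "increment c b [] = (if c = 0 \<and> b = 0 then [] else [(c, b)])"
| "increment c b ((d, e) # ps) =
    (if c = 0 \<and> b = 0 then (d, e) # ps
     else (if d + c \<le> 16 then d + c else 1, (e + b) mod 4)
            # increment (of_bool (d + c > 16)) ((e + b) div 4) ps)"

fun count_value :: "(nat \<times> nat) list \<Rightarrow> nat" where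
  "count_value [] = 0"
| "count_value ((d, e) # ps) = d + 16 * count_value ps"

fun heads_value :: "(nat \<times> nat) list \<Rightarrow> nat" where
  "heads_value [] = 0"
| "heads_value ((d, e) # ps) = e + 4 * heads_value ps"

fun valid_counters :: "(nat \<times> nat) list \<Rightarrow> bool" where
  "valid_counters [] \<longleftrightarrow> True"
| "valid_counters ((d, e) # ps) \<longleftrightarrow>
    d \<le> 16 \<and> e < 4 \<and> (d = 0 \<longrightarrow> count_value ps = 0) \<and> (ps = [] \<longrightarrow> 0 < d + e) \<and> valid_counters ps"

lemma increment_0: "increment 0 0 ps = ps"
  by (cases ps) auto

text \<open>In every cell the new digit plus base times outgoing carry equals the old digit plus
  incoming carry, for both counters at once.\<close>

lemma increment_correct:
  assumes "valid_counters ps" "c \<le> 1" "b \<le> 1"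
  shows "valid_counters (increment c b ps) \<and> count_value (increment c b ps) = count_value ps + c \<and>
    heads_value (increment c b ps) = heads_value ps + b \<and>
    (c \<noteq> 0 \<or> b \<noteq> 0 \<longrightarrow> increment c b ps \<noteq> [])"
  using assms
proof (induction c b ps rule: increment.induct)
  case (1 c b)
  then show ?case by auto
next
  case (2 c b d e ps)
  show ?case
  proof (cases "c = 0 \<and> b = 0")
    case False
    have b: "(e + b) div 4 \<le> 1" "b = 0 \<or> b = 1" "c = 0 \<or> c = 1" using 2 by auto
    define c' :: nat where "c' = of_bool (16 < d + c)"
    define b' where "b' = (e + b) div 4"
    define d' where "d' = (if d + c \<le> 16 then d + c else 1)"
    define e' where "e' = (e + b) mod 4"
    define qs where "qs = increment c' b' ps"
    have inc: "increment c b ((d, e) # ps) = (d', e') # qs"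
      using False by (auto simp: d'_def e'_def qs_def c'_def b'_def)
    have "valid_counters qs \<and> count_value qs = count_value ps + c' \<and> heads_value qs = heads_value ps + b' \<and>
        (c' \<noteq> 0 \<or> b' \<noteq> 0 \<longrightarrow> qs \<noteq> [])"
      unfolding qs_def b'_def c'_def using 2 False b(1) by auto
    \<comment> \<open>Bijective digits overflow from 16 to 1, so a count digit 0 survives only where
      no carry arrives.\<close>
    moreover have "d' + 16 * c' = d + c" "d' \<le> 16" "d' = 0 \<longrightarrow> d = 0 \<and> c' = 0"
      using 2(2) b(3) by (auto simp: d'_def c'_def)
    moreover have "e' + 4 * b' = e + b" "e' < 4" "e' = 0 \<longrightarrow> e = 0 \<and> b' = 0 \<or> b' \<noteq> 0"
      using b by (auto simp: e'_def b'_def)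
    \<comment> \<open>The list never shrinks, so a cell that is topmost afterwards was topmost
      before and held a nonzero digit.\<close>
    moreover have "qs = [] \<longrightarrow> ps = []"
      unfolding qs_def by (cases ps) (auto split: if_splits)
    moreover have "d = 0 \<longrightarrow> count_value ps = 0" "valid_counters ps" "ps = [] \<longrightarrow> (d, e) \<noteq> (0, 0)"
      using 2(2) by auto
    ultimately have "valid_counters ((d', e') # qs)"
      "count_value ((d', e') # qs) = count_value ((d, e) # ps) + c"
      "heads_value ((d', e') # qs) = heads_value ((d, e) # ps) + b"
      by auto
    then show ?thesis unfolding inc by blast
  qed (use 2 in auto)
qed

text \<open>The topmost cell has a nonzero digit in one of the counters, and its weight there is at
  least \<open>4 ^ (length ps - 1)\<close>.\<close>

lemma length_valid_counters:
  "valid_counters ps \<Longrightarrow> ps \<noteq> [] \<Longrightarrow> 4 ^ length ps \<le> 4 * (count_value ps + heads_value ps)"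
proof (induction ps rule: valid_counters.induct)
  case (2 d e ps)
  show ?case
  proof (cases "ps = []")
    case True
    then have "1 \<le> d + e" using 2(2) unfolding valid_counters.simps by linarith
    then show ?thesis using True by simp
  next
    case False
    then have "4 ^ length ps \<le> 4 * (count_value ps + heads_value ps)"
      using 2(1,2) by simp
    then show ?thesis by simp
  qed
qed simp

fun repunit :: "nat \<Rightarrow> nat" where
  "repunit 0 = 0"
| "repunit (Suc k) = 1 + 16 * repunit k"

text \<open>Skips the digits 1 of the count and tests the heads digit just above them. Running off
  the list means a blank cell, hence heads digit 0. Besides the intended digit 2, digit 1 is
  accepted to allow for a heads count slightly too small.\<close>

fun check_counters :: "(nat \<times> nat) list \<Rightarrow> bool" where
  "check_counters [] \<longleftrightarrow> False"
| "check_counters ((d, e) # ps) \<longleftrightarrow> (if d = 1 then check_counters ps else d = 0 \<and> e \<in> {1, 2})"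

definition marked :: "nat \<Rightarrow> nat \<Rightarrow> bool" where
  "marked n h \<longleftrightarrow> (\<exists>k. n = repunit k \<and> h div 4 ^ k mod 4 \<in> {1, 2})"

lemma repunit_eq_0: "0 = repunit k \<longleftrightarrow> k = 0"
  by (cases k) auto

lemma repunit_real: "15 * real (repunit k) = 16 ^ k - 1"
proof (induction k)
  case (Suc k)
  then show ?case by (simp add: distrib_left) 
qed simp

lemma repunit_inj: "repunit i = repunit j \<longleftrightarrow> i = j"
proof
  assume "repunit i = repunit j"
  then have "(16::real) ^ i = 16 ^ j" using repunit_real[of i] repunit_real[of j] by linarith
  then show "i = j" by simp
qed simp

text \<open>Dropping a lowest cell with count digit 1 lowers \<open>k\<close> by one and divides the
  heads value by 4.\<close>

lemma check_iff_marked: "valid_counters ps \<Longrightarrow> check_counters ps \<longleftrightarrow> marked (count_value ps) (heads_value ps)"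
proof (induction ps)
  case Nil
  then show ?case by (auto simp: marked_def)
next
  case (Cons a ps)
  obtain d e where [simp]: "a = (d, e)" by force
  have v: "d \<le> 16" "e < 4" "d = 0 \<longrightarrow> count_value ps = 0" "valid_counters ps" using Cons.prems by auto
  consider "d = 0" | "d = 1" | "2 \<le> d" by linarith
  then show ?case
  proof cases
    case 1
    have "(e + 4 * heads_value ps) mod 4 = e" using v by simp
    then show ?thesis using 1 v by (auto simp: marked_def repunit_eq_0)
  next
    case 2
    have "count_value (a # ps) = repunit k \<longleftrightarrow> (\<exists>k'. k = Suc k' \<and> count_value ps = repunit k')" for k
      using 2 by (cases k) auto
    moreover have "(e + 4 * heads_value ps) div 4 ^ Suc k = heads_value ps div 4 ^ k" for k
      using v by (simp add: div_mult2_eq)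
    ultimately have "marked (count_value (a # ps)) (heads_value (a # ps)) =
      marked (count_value ps) (heads_value ps)"
      unfolding marked_def by auto
    then show ?thesis using Cons.IH v(4) 2 by simp
  next
    case 3
    \<comment> \<open>A repunit is 0 or congruent to 1 modulo 16, and neither is possible with a
      lowest digit from 2 to 16.\<close>
    have "d + 16 * count_value ps \<noteq> repunit k" for k
      using 3 v by (cases k) (auto, presburger)
    then show ?thesis using 3 by (simp add: marked_def)
  qed
qed

section \<open>Reading a digit off the number of heads\<close>

text \<open>Base-4 digits 0 and 2 only, with index 0 at the units place. The digits after any place
  then amount to at most 2/3 of its unit, which leaves room for errors.\<close>

definition expansion :: "nat set \<Rightarrow> real" where
  "expansion I = (\<Sum>i. 2 * of_bool (i \<in> I) / 4 ^ i)"

lemma summable_expansion: "summable (\<lambda>i. 2 * of_bool (i \<in> I) / 4 ^ (i + k) :: real)"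
proof (rule summable_comparison_test')
  show "summable (\<lambda>i. 2 * (1 / 4) ^ i :: real)"
    by (intro summable_mult summable_geometric) simp
  show "norm (2 * of_bool (i \<in> I) / 4 ^ (i + k) :: real) \<le> 2 * (1 / 4) ^ i" if "i \<ge> 0" for i
    by (auto simp: power_one_over field_simps power_add)
qed

lemma expansion_bounds: "0 \<le> expansion I \<and> expansion I \<le> 8 / 3"
proof -
  have g: "(\<lambda>i. 2 * (1 / 4) ^ i :: real) sums (2 * (1 / (1 - 1 / 4)))"
    by (intro sums_mult geometric_sums) simp
  have "expansion I \<le> (\<Sum>i. 2 * (1 / 4) ^ i :: real)"
    unfolding expansion_def using summable_expansion[of I 0] sums_summable[OF g]
    by (intro suminf_le) (auto simp: power_one_over field_simps)
  moreover have "0 \<le> expansion I"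
    unfolding expansion_def using summable_expansion[of I 0] by (intro suminf_nonneg) auto
  ultimately show ?thesis using sums_unique[OF g] by simp
qed

lemma expansion_Suc:
  "expansion I = 2 * of_bool (0 \<in> I) + expansion {i. Suc i \<in> I} / 4"
proof -
  have "expansion I = 2 * of_bool (0 \<in> I) + (\<Sum>i. 2 * of_bool (Suc i \<in> I) / 4 ^ Suc i)"
    unfolding expansion_def using suminf_split_head[of "\<lambda>i. 2 * of_bool (i \<in> I) / 4 ^ i :: real"]
      summable_expansion[of I 0] by simp
  also have "(\<lambda>i. 2 * of_bool (Suc i \<in> I) / 4 ^ Suc i :: real) =
      (\<lambda>i. 2 * of_bool (i \<in> {i. Suc i \<in> I}) / 4 ^ i / 4)"
    by auto
  also have "suminf \<dots> = expansion {i. Suc i \<in> I} / 4"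
    unfolding expansion_def using summable_expansion[of "{i. Suc i \<in> I}" 0]
    by (intro suminf_divide) simp
  finally show ?thesis .
qed

text \<open>The digits before place \<open>k\<close> get weights divisible by 4, so modulo 4 only
  digit \<open>k\<close> and its tail remain.\<close>

lemma expansion_shift:
  "\<exists>N::int. 4 ^ k * expansion I = 4 * of_int N + expansion {i. i + k \<in> I}"
proof (induction k)
  case 0
  show ?case by (auto intro: exI[of _ 0])
next
  case (Suc k)
  then obtain N :: int where N: "4 ^ k * expansion I = 4 * of_int N + expansion {i. i + k \<in> I}" ..
  have "4 ^ Suc k * expansion I = 4 * (4 ^ k * expansion I)" by simp
  also have "\<dots> = 4 * of_int (4 * N + 2 * of_bool (k \<in> I)) + expansion {i. i + Suc k \<in> I}"
    unfolding N by (subst (1) expansion_Suc) (simp add: algebra_simps)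
  finally show ?case by blast
qed

text \<open>Three leading zeros bound the expansion by (8/3) / 64 = 1/24, which makes 15 times it a
  legitimate coin bias.\<close>

lemma expansion_le_of_small:
  assumes "I \<inter> {..<3} = {}"
  shows "15 * expansion I \<le> 1"
proof -
  have [simp]: "0 \<notin> I" "Suc 0 \<notin> I" "Suc (Suc 0) \<notin> I"
    using assms by (auto simp: numeral_3_eq_3)
  have "expansion I = expansion {i. Suc (Suc (Suc i)) \<in> I} / 64"
    by (simp add: expansion_Suc[of I] expansion_Suc[of "{i. Suc i \<in> I}"]
        expansion_Suc[of "{i. Suc (Suc i) \<in> I}"])
  then show ?thesis using expansion_bounds[of "{i. Suc (Suc (Suc i)) \<in> I}"] by simp
qed

text \<open>By \<open>repunit_real\<close> the mean is \<open>4 ^ k * (4 ^ k * q) - q\<close>, so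
  \<open>h / 4 ^ k\<close> is within 1/4 + 1/15 of \<open>4 ^ k * q\<close>, which is a multiple of
  4 plus the digit plus a tail \<open>r\<close> in [0, 2/3].\<close>

lemma digit_close:
  assumes I: "I \<inter> {..<3} = {}"
    and h: "\<bar>real h - real (repunit k) * (15 * expansion I)\<bar> < 4 ^ k / 4"
  shows "h div 4 ^ k mod 4 \<in> {1, 2} \<longleftrightarrow> k \<in> I"
proof -
  define q where "q = expansion I"
  have q: "0 \<le> q" "q \<le> 1 / 15"
    using expansion_bounds[of I] expansion_le_of_small[OF I] by (auto simp: q_def)
  obtain N :: int where N: "4 ^ k * q = 4 * of_int N + expansion {i. i + k \<in> I}"
    using expansion_shift[of k I] unfolding q_def by auto
  define r where "r = expansion {i. Suc i + k \<in> I} / 4"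
  have r: "0 \<le> r" "r \<le> 2 / 3" using expansion_bounds by (auto simp: r_def)
  have N': "4 ^ k * q = 4 * of_int N + 2 * of_bool (k \<in> I) + r"
    unfolding N r_def by (subst expansion_Suc) simp
  define y where "y = real h / 4 ^ k"
  have "real (repunit k) * (15 * q) = (16 ^ k - 1) * q"
    unfolding repunit_real[symmetric] by simp
  also have "(16::real) ^ k = 4 ^ k * 4 ^ k"
    by (simp flip: power_mult_distrib)
  finally have E: "real (repunit k) * (15 * q) = 4 ^ k * (4 ^ k * q) - q"
    by (simp add: algebra_simps)
  have "real h = 4 ^ k * y" by (simp add: y_def)
  then have "\<bar>4 ^ k * y - (4 ^ k * (4 ^ k * q) - q)\<bar> < 4 ^ k / 4"
    using h unfolding q_def[symmetric] E by simp
  then have "\<bar>4 ^ k * (y - 4 ^ k * q)\<bar> < 4 ^ k / 4 + q"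
    using q(1) unfolding right_diff_distrib by linarith
  \<comment> \<open>The stray term \<open>q\<close> is at most 1/15, hence at most
    \<open>4 ^ k / 15\<close>.\<close>
  also have "\<dots> \<le> 4 ^ k * (1 / 4 + 1 / 15)"
    using q(2) one_le_power[of "4::real" k] unfolding distrib_left by linarith
  finally have "(4::real) ^ k * \<bar>y - 4 ^ k * q\<bar> < 4 ^ k * (1 / 4 + 1 / 15)"
    by (simp add: abs_mult)
  then have y: "\<bar>y - 4 ^ k * q\<bar> < 1 / 4 + 1 / 15"
    by (simp only: mult_less_cancel_left_pos zero_less_power zero_less_numeral)
  define z where "z = h div 4 ^ k"
  have fl: "int z = \<lfloor>y\<rfloor>"
    unfolding y_def z_def using floor_divide_of_nat_eq[of h "4 ^ k", where 'a=real] by simp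
  show ?thesis
  proof (cases "k \<in> I")
    case True
    then have "4 ^ k * q = 4 * of_int N + 2 + r" using N' by simp
    \<comment> \<open>Upwards the total error is below 2/3 + 1/4 + 1/15 = 59/60, downwards below
      19/60. So digit 2 is read as 1 or 2, and digit 0 as 3 or 0.\<close>
    then have "4 * of_int N + 1 \<le> y" "y < 4 * of_int N + 3" using y r by linarith+
    then have "4 * N + 1 \<le> \<lfloor>y\<rfloor>" "\<lfloor>y\<rfloor> < 4 * N + 3" by linarith+
    then have "z mod 4 = 1 \<or> z mod 4 = 2" unfolding fl[symmetric] by presburger
    then show ?thesis using True by (simp add: z_def)
  next
    case False
    then have "4 ^ k * q = 4 * of_int N + r" using N' by simp
    then have "4 * of_int N - 1 \<le> y" "y < 4 * of_int N + 1" using y r by linarith+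
    then have "4 * N - 1 \<le> \<lfloor>y\<rfloor>" "\<lfloor>y\<rfloor> < 4 * N + 1" by linarith+
    then have "z mod 4 \<noteq> 1 \<and> z mod 4 \<noteq> 2" unfolding fl[symmetric] by presburger
    then show ?thesis using False by (simp add: z_def)
  qed
qed

text \<open>Hoeffding's inequality; the case of no trials is separate because the exponent divides
  by their number.\<close>

lemma binomial_deviation:
  assumes "0 \<le> p" "p \<le> 1"
  shows "measure_pmf.prob (binomial_pmf (repunit k) p)
    {h. \<bar>real h - real (repunit k) * p\<bar> \<ge> 4 ^ k / 4} \<le> 4 / 9"
proof (cases "k = 0")
  case True
  then show ?thesis using assms by (simp add: binomial_pmf_0)
next
  case False
  interpret binomial_distribution "repunit k" p
    using assms by unfold_locales auto
  have pos: "0 < repunit k" using False repunit_eq_0[of k] by linarith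
  have "measure_pmf.prob (binomial_pmf (repunit k) p)
      {h. \<bar>real h - real (repunit k) * p\<bar> \<ge> 4 ^ k / 4}
    \<le> 2 * exp (- 2 * (4 ^ k / 4)\<^sup>2 / real (repunit k))"
    by (rule prob_abs_ge) (use pos in auto)
  also have "\<dots> \<le> 2 * exp (- (15 / 8))"
  proof -
    have "((4::real) ^ k / 4)\<^sup>2 = 16 ^ k / 16"
      by (simp add: power2_eq_square flip: power_mult_distrib)
    \<comment> \<open>Uses \<open>15 * repunit k < 16 ^ k\<close>, so the bound is uniform in
      \<open>k\<close>.\<close>
    then have "15 / 8 \<le> 2 * ((4::real) ^ k / 4)\<^sup>2 / real (repunit k)"
      using pos repunit_real[of k] by (simp add: field_simps)
    then show ?thesis by simp
  qed
  also have "\<dots> \<le> 4 / 9"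
  proof -
    \<comment> \<open>The left side is 593/128, just above 9/2.\<close>
    have "1 + 15 / 8 + (15 / 8)\<^sup>2 / 2 \<le> exp (15 / 8 :: real)"
      by (rule exp_lower_Taylor_quadratic) simp
    then have "9 / 2 \<le> exp (15 / 8 :: real)" by (simp add: power2_eq_square)
    then show ?thesis by (simp add: exp_minus field_simps)
  qed
  finally show ?thesis .
qed

text \<open>Unless the heads count deviates by \<open>4 ^ k / 4\<close> or more, the test gives the
  correct answer; hence both error probabilities are at most 4/9.\<close>

lemma prob_marked:
  fixes I k
  assumes I: "I \<inter> {..<3} = {}"
  defines "P \<equiv> measure_pmf.prob (binomial_pmf (repunit k) (15 * expansion I))
    {h. marked (repunit k) h}"
  shows "k \<in> I \<Longrightarrow> P \<ge> 5 / 9" "k \<notin> I \<Longrightarrow> P \<le> 4 / 9"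
proof -
  let ?B = "binomial_pmf (repunit k) (15 * expansion I)"
  let ?D = "{h. \<bar>real h - real (repunit k) * (15 * expansion I)\<bar> \<ge> 4 ^ k / 4}"
  have D: "measure_pmf.prob ?B ?D \<le> 4 / 9"
    using expansion_bounds[of I] expansion_le_of_small[OF I] by (intro binomial_deviation) auto
  have m: "marked (repunit k) h \<longleftrightarrow> h div 4 ^ k mod 4 \<in> {1, 2}" for h
    by (auto simp: marked_def repunit_inj)
  have close: "marked (repunit k) h \<longleftrightarrow> k \<in> I" if "h \<notin> ?D" for h
    unfolding m using that by (intro digit_close[OF I]) auto
  show "P \<le> 4 / 9" if "k \<notin> I"
  proof -
    have "P \<le> measure_pmf.prob ?B ?D"
      unfolding P_def using close that by (intro measure_pmf.finite_measure_mono) auto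
    then show ?thesis using D by simp
  qed
  show "P \<ge> 5 / 9" if "k \<in> I"
  proof -
    have "1 - measure_pmf.prob ?B ?D = measure_pmf.prob ?B (- ?D)"
      by (simp add: measure_pmf.prob_compl[of ?D ?B, simplified] Compl_eq_Diff_UNIV)
    also have "\<dots> \<le> P"
      unfolding P_def using close that by (intro measure_pmf.finite_measure_mono) auto
    finally show ?thesis using D by simp
  qed
qed

section \<open>The machine\<close>

text \<open>The offset 1 reserves symbol 0 for the blank; the largest code is 1 + 4 * 16 + 3 = 68,
  whence 69 symbols.\<close>

definition encode :: "nat \<times> nat \<Rightarrow> nat" where
  "encode = (\<lambda>(d, e). 1 + 4 * d + e)"

definition count_digit :: "nat \<Rightarrow> nat" where
  "count_digit g = (g - 1) div 4"

definition heads_digit :: "nat \<Rightarrow> nat" where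
  "heads_digit g = (g - 1) mod 4"

text \<open>
  States: 0 accepts, 1 rejects, 2 waits on cell 0 for the next input symbol, 3 scans the counters at
  the end of the input, 4 returns to the blank cell \<open>-1\<close>, and \<open>4 + c + 2 * b\<close> propagates the carries
  \<open>c\<close> and \<open>b\<close>, not both 0. A blank cell reads as the digits \<open>(0, 0)\<close>.
\<close>

definition counting_trans ::
    "real \<Rightarrow> nat \<Rightarrow> unit tape_symbol \<Rightarrow> nat \<Rightarrow> (nat \<times> nat \<times> move \<times> move) pmf" where
  "counting_trans p q a g =
    (if q = 2 then
       (case a of
          LeftEnd \<Rightarrow> return_pmf (2, g, MRight, MStay)
        | Letter _ \<Rightarrow> map_pmf (\<lambda>heads. (if heads then 7 else 5, g, MRight, MStay)) (bernoulli_pmf p)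
        | Dollar \<Rightarrow> return_pmf (3, g, MStay, MStay))
     else if q = 3 then
       return_pmf
         (if count_digit g = 1 then (3, g, MStay, MRight)
          else (if count_digit g = 0 \<and> heads_digit g \<in> {1, 2} then 0 else 1, g, MStay, MStay))
     else if q = 4 then
       return_pmf (if g = 0 then (2, g, MStay, MRight) else (4, g, MStay, MLeft))
     else
       (let d = count_digit g + (q - 4) mod 2; e = heads_digit g + (q - 4) div 2;
            q' = 4 + of_bool (d > 16) + 2 * (e div 4)
        in return_pmf (q', encode (if d \<le> 16 then d else 1, e mod 4), MStay,
             if q' = 4 then MLeft else MRight)))"

definition counting_ptm :: "real \<Rightarrow> (nat, nat, unit) ptm" where
  "counting_ptm p = \<lparr>states = {..<8}, symbols = {..<69}, blank = 0, start = 2, acc = 0, rej = 1,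
     trans = counting_trans p\<rparr>"

lemma counting_ptm_simps [simp]:
  "states (counting_ptm p) = {..<8}" "symbols (counting_ptm p) = {..<69}"
  "blank (counting_ptm p) = 0" "start (counting_ptm p) = 2" "acc (counting_ptm p) = 0"
  "rej (counting_ptm p) = 1" "ptm.trans (counting_ptm p) = counting_trans p"
  by (simp_all add: counting_ptm_def)

lemma halting_counting_ptm [simp]: "halting (counting_ptm p) q \<longleftrightarrow> q = 0 \<or> q = 1"
  by (simp add: halting_def)

text \<open>Serves both well-formedness and one-wayness.\<close>

lemma counting_trans_bounds:
  assumes "q < 8" "g < 69" "q \<noteq> 0" "q \<noteq> 1"
    and s: "(q', g', x, y) \<in> set_pmf (counting_trans p q a g)"
  shows "q' < 8 \<and> g' < 69 \<and> x \<noteq> MLeft \<and> (a = Dollar \<longrightarrow> x \<noteq> MRight)"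
proof -
  consider "q = 2" | "q = 3" | "q = 4" | "q = 5 \<or> q = 6 \<or> q = 7"
    using assms(1,3,4) by linarith
  then show ?thesis
  proof cases
    case 4
    define d where "d = count_digit g + (q - 4) mod 2"
    define e where "e = heads_digit g + (q - 4) div 2"
    have "e div 4 \<le> 1" "e mod 4 < 4"
      using 4 by (auto simp: e_def heads_digit_def)
    moreover have "(q', g', x, y) = (4 + of_bool (d > 16) + 2 * (e div 4),
        encode (if d \<le> 16 then d else 1, e mod 4), MStay,
        if 4 + of_bool (d > 16) + 2 * (e div 4) = 4 then MLeft else MRight)"
      using s 4 by (auto simp: counting_trans_def Let_def d_def e_def)
    ultimately show ?thesis by (auto simp: encode_def)
  qed (use assms in \<open>auto simp: counting_trans_def split: tape_symbol.splits if_splits\<close>)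
qed

lemma is_ptm_counting_ptm: "is_ptm (counting_ptm p)"
  unfolding is_ptm_def by (auto dest: counting_trans_bounds)

lemma one_way_counting_ptm: "one_way (counting_ptm p)"
  unfolding one_way_def by (auto dest: counting_trans_bounds)

section \<open>Configurations whose work tape holds the counters\<close>

definition tape :: "(nat \<times> nat) list \<Rightarrow> int \<Rightarrow> nat" where
  "tape ps i = (if 0 \<le> i \<and> nat i < length ps then encode (ps ! nat i) else 0)"

definition counting_config :: "nat \<Rightarrow> nat \<Rightarrow> int \<Rightarrow> (nat \<times> nat) list \<Rightarrow> (nat, nat) config" where
  "counting_config q i j ps = \<lparr>cstate = q, ihead = i, whead = j, wtape = tape ps\<rparr>"

lemma counting_config_simps [simp]:
  "cstate (counting_config q i j ps) = q" "ihead (counting_config q i j ps) = i"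
  "whead (counting_config q i j ps) = j" "wtape (counting_config q i j ps) = tape ps"
  by (simp_all add: counting_config_def)

lemma tape_append:
  "tape (pre @ ps) (int (length pre)) = (case ps of [] \<Rightarrow> 0 | x # _ \<Rightarrow> encode x)"
  by (auto simp: tape_def nth_append split: list.split)

text \<open>As \<open>tl [] = []\<close>, this covers both overwriting a cell and appending a new
  one at the end.\<close>

lemma tape_update:
  "(tape (pre @ ps))(int (length pre) := encode x) = tape (pre @ x # tl ps)"
proof
  fix i
  consider "i < int (length pre)" | "i = int (length pre)" | m where "i = int (length pre + Suc m)"
    using zless_iff_Suc_zadd[of "int (length pre)" i] by fastforce
  then show "((tape (pre @ ps))(int (length pre) := encode x)) i = tape (pre @ x # tl ps) i"
    by cases (cases ps; auto simp: tape_def nth_append nat_int_add)+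
qed

lemma encode_neq_0 [simp]: "encode x \<noteq> 0"
  by (simp add: encode_def split: prod.split)

lemma digits_encode [simp]:
  "e < 4 \<Longrightarrow> count_digit (encode (d, e)) = d" "e < 4 \<Longrightarrow> heads_digit (encode (d, e)) = e"
  "count_digit 0 = 0" "heads_digit 0 = 0"
  by (simp_all add: encode_def count_digit_def heads_digit_def)

lemma apply_keep:
  "apply_action (counting_config q i j ps) (q', tape ps j, x, y) =
   counting_config q' (move_input x i) (move_work y j) ps"
  by (simp add: apply_action_def counting_config_def)

lemma step_counting_config:
  "q \<noteq> 0 \<Longrightarrow> q \<noteq> 1 \<Longrightarrow> step (counting_ptm p) w (counting_config q i j ps) =
    map_pmf (apply_action (counting_config q i j ps))
      (counting_trans p q (input_at w i) (tape ps j))"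
  by (simp add: step_def)

section \<open>Certificates for the sweeps over the work tape\<close>

context
  fixes p :: real and w :: "unit list" and L :: nat
begin

abbreviation counting_halts where
  "counting_halts \<equiv> halts_with (counting_ptm p) w {- 1..int L}"

text \<open>Certificates are built backwards, from where a sweep ends to where it starts. Here
  \<open>k\<close> moves reach cell -1 and one more move reaches cell 0.\<close>

lemma counting_halts_return:
  assumes "counting_halts t (counting_config 2 i 0 ps) a" "length ps \<le> L" "k \<le> length ps"
  shows "counting_halts (t + k + 1) (counting_config 4 i (int k - 1) ps) a"
  using assms(3)
proof (induction k)
  case 0
  have "step (counting_ptm p) w (counting_config 4 i (- 1) ps) = return_pmf (counting_config 2 i 0 ps)"
    using apply_keep[of 4 i "- 1" ps 2 MStay MRight]
    by (simp add: step_counting_config counting_trans_def tape_def)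
  from halts_with_det[OF this] assms(1) show ?case by simp
next
  case (Suc k)
  \<comment> \<open>Counter cells carry nonzero symbols, so the sweep cannot stop before the blank
    cell -1.\<close>
  have "tape ps (int k) \<noteq> 0" using Suc.prems by (simp add: tape_def)
  then have "step (counting_ptm p) w (counting_config 4 i (int k) ps) =
      return_pmf (counting_config 4 i (int k - 1) ps)"
    using apply_keep[of 4 i "int k" ps 4 MStay MLeft]
    by (simp add: step_counting_config counting_trans_def)
  from halts_with_det[OF this] Suc assms(2) show ?case by simp
qed

text \<open>A cell beyond the list counts as the digits (0, 0), so growing the list needs no
  separate rule.\<close>

lemma step_carry:
  fixes c b :: nat
  assumes "c \<le> 1" "b \<le> 1" "c \<noteq> 0 \<or> b \<noteq> 0" "\<forall>(d, e)\<in>set ps. e < 4"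
  defines "d \<equiv> (case ps of [] \<Rightarrow> 0 | x # _ \<Rightarrow> fst x) + c"
    and "e \<equiv> (case ps of [] \<Rightarrow> 0 | x # _ \<Rightarrow> snd x) + b"
  defines "q' \<equiv> 4 + of_bool (d > 16) + 2 * (e div 4)"
  shows "step (counting_ptm p) w (counting_config (4 + c + 2 * b) i (int (length pre)) (pre @ ps)) =
    return_pmf (counting_config q' i (int (length pre) + (if q' = 4 then - 1 else 1))
      (pre @ (if d \<le> 16 then d else 1, e mod 4) # tl ps))"
proof -
  have q: "4 + c + 2 * b \<noteq> 0" "4 + c + 2 * b \<noteq> 1" "4 + c + 2 * b \<noteq> 2"
    "4 + c + 2 * b \<noteq> 3" "4 + c + 2 * b \<noteq> 4"
    "(4 + c + 2 * b - 4) mod 2 = c" "(4 + c + 2 * b - 4) div 2 = b"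
    using assms(1-3) by auto
  let ?g = "tape (pre @ ps) (int (length pre))"
  have g: "count_digit ?g + c = d" "heads_digit ?g + b = e"
    unfolding d_def e_def tape_append using assms(4) by (auto split: list.split)
  have tr: "counting_trans p (4 + c + 2 * b) (input_at w i) ?g =
      return_pmf (q', encode (if d \<le> 16 then d else 1, e mod 4), MStay,
        if q' = 4 then MLeft else MRight)"
    unfolding counting_trans_def Let_def q g q'_def using q(3-5) by auto
  show ?thesis
    unfolding step_counting_config[OF q(1,2)] tr
    by (simp add: apply_action_def counting_config_def flip: tape_update)
qed

text \<open>The machine follows the recursion of \<open>increment\<close>, with \<open>pre\<close>
  the cells already passed: at most one step per cell of the result, then the return sweep.\<close>

lemma counting_halts_increment:
  assumes "c \<le> 1" "b \<le> 1" "c \<noteq> 0 \<or> b \<noteq> 0" "\<forall>(d, e)\<in>set ps. e < 4"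
    and "length (pre @ increment c b ps) \<le> L"
    and "counting_halts t (counting_config 2 i 0 (pre @ increment c b ps)) a"
  shows "counting_halts (t + length (increment c b ps) + length (pre @ increment c b ps) + 1)
    (counting_config (4 + c + 2 * b) i (int (length pre)) (pre @ ps)) a"
  using assms
proof (induction c b ps arbitrary: pre rule: increment.induct)
  case (1 c b)
  have inc: "increment c b [] = [(c, b)]" using 1 by auto
  have "step (counting_ptm p) w (counting_config (4 + c + 2 * b) i (int (length pre)) (pre @ [])) =
      return_pmf (counting_config 4 i (int (length pre) - 1) (pre @ [(c, b)]))"
    using 1 by (subst step_carry) auto
  moreover have "counting_halts (t + length pre + 1)
      (counting_config 4 i (int (length pre) - 1) (pre @ [(c, b)])) a"
    using 1 by (intro counting_halts_return) (auto simp: inc)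
  ultimately have "counting_halts (Suc (t + length pre + 1))
      (counting_config (4 + c + 2 * b) i (int (length pre)) (pre @ [])) a"
    using 1 by (intro halts_with_det) (auto simp: inc)
  then show ?case unfolding inc by (rule halts_with_mono) simp
next
  case (2 c b d e ps)
  define c' :: nat where "c' = of_bool (d + c > 16)"
  define b' where "b' = (e + b) div 4"
  define x where "x = (if d + c \<le> 16 then d + c else 1, (e + b) mod 4)"
  have inc: "increment c b ((d, e) # ps) = x # increment c' b' ps"
    using 2(4) by (auto simp: x_def c'_def b'_def)
  have e: "e < 4" using 2(5) by auto
  have st: "step (counting_ptm p) w
      (counting_config (4 + c + 2 * b) i (int (length pre)) (pre @ (d, e) # ps)) =
    return_pmf (counting_config (4 + c' + 2 * b') i
      (int (length pre) + (if c' = 0 \<and> b' = 0 then - 1 else 1)) (pre @ x # ps))"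
    using 2(2-5) by (subst step_carry) (auto simp: x_def c'_def b'_def)
  have "counting_halts (t + length (increment c' b' ps) + length (pre @ x # increment c' b' ps) + 1)
    (counting_config (4 + c' + 2 * b') i
      (int (length pre) + (if c' = 0 \<and> b' = 0 then - 1 else 1)) (pre @ x # ps)) a"
  proof (cases "c' = 0 \<and> b' = 0")
    case True
    \<comment> \<open>Both carries have died out, so the remaining cells are already final and the
      return begins early.\<close>
    then have "counting_halts (t + length pre + 1)
        (counting_config 4 i (int (length pre) - 1) (pre @ x # ps)) a"
      using 2(6,7) unfolding inc by (intro counting_halts_return) (auto simp: increment_0)
    then show ?thesis using True by (auto intro: halts_with_mono)
  next
    case False
    have "c' \<le> 1" "b' \<le> 1" using 2(3) e by (auto simp: c'_def b'_def)
    have "counting_halts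
        (t + length (increment c' b' ps) + length ((pre @ [x]) @ increment c' b' ps) + 1)
        (counting_config (4 + c' + 2 * b') i (int (length (pre @ [x]))) ((pre @ [x]) @ ps)) a"
      by (rule 2(1)[folded c'_def b'_def])
        (use \<open>c' \<le> 1\<close> \<open>b' \<le> 1\<close> 2(4,5) 2(6,7)[unfolded inc] False in auto)
    then show ?thesis using False by (auto simp: add.commute)
  qed
  with st have "counting_halts
     (Suc (t + length (increment c' b' ps) + length (pre @ x # increment c' b' ps) + 1))
     (counting_config (4 + c + 2 * b) i (int (length pre)) (pre @ (d, e) # ps)) a"
    using 2(4,6) by (intro halts_with_det) (auto simp: inc)
  then show ?case unfolding inc by simp
qed

lemma counting_halts_check:
  assumes "\<forall>(d, e)\<in>set ps. e < 4" "length (pre @ ps) \<le> L"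
  shows "counting_halts (length ps + 1) (counting_config 3 i (int (length pre)) (pre @ ps))
    (of_bool (check_counters ps))"
  using assms
proof (induction ps arbitrary: pre)
  case Nil
  have "step (counting_ptm p) w (counting_config 3 i (int (length pre)) (pre @ [])) =
      return_pmf (counting_config 1 i (int (length pre)) (pre @ []))"
    using apply_keep[of 3 i "int (length pre)" "pre @ []" 1 MStay MStay] tape_append[of pre "[]"]
    by (simp add: step_counting_config counting_trans_def)
  from halts_with_det[OF this] show ?case
    using Nil halts_with.halt[of "counting_ptm p" "counting_config 1 i (int (length pre)) (pre @ [])"
      "{- 1..int L}" w 0] by simp
next
  case (Cons x ps)
  obtain d e where x: "x = (d, e)" by force
  have e: "e < 4" using Cons.prems(1) by (simp add: x)
  define q where "q = (if d = 0 \<and> e \<in> {1, 2} then 0 else 1 :: nat)"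
  show ?case
  proof (cases "d = 1")
    case True
    have st: "step (counting_ptm p) w (counting_config 3 i (int (length pre)) (pre @ x # ps)) =
        return_pmf (counting_config 3 i (int (length (pre @ [x]))) ((pre @ [x]) @ ps))"
      using apply_keep[of 3 i "int (length pre)" "pre @ x # ps" 3 MStay MRight] True e
        tape_append[of pre "x # ps"]
      by (simp add: step_counting_config counting_trans_def x add.commute)
    have ha: "counting_halts (length ps + 1)
        (counting_config 3 i (int (length (pre @ [x]))) ((pre @ [x]) @ ps)) (of_bool (check_counters ps))"
      using Cons.prems by (intro Cons.IH) auto
    show ?thesis
      using Cons.prems True halts_with_det[OF st _ _ ha] by (simp add: x)
  next
    case False
    have q: "q = 0 \<or> q = 1" "check_counters (x # ps) \<longleftrightarrow> q = 0"
      using False by (auto simp: q_def x)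
    have st: "step (counting_ptm p) w (counting_config 3 i (int (length pre)) (pre @ x # ps)) =
        return_pmf (counting_config q i (int (length pre)) (pre @ x # ps))"
      using apply_keep[of 3 i "int (length pre)" "pre @ x # ps" q MStay MStay] False e
        tape_append[of pre "x # ps"]
      by (simp add: step_counting_config counting_trans_def x q_def)
    have ha: "counting_halts (length ps + 1)
        (counting_config q i (int (length pre)) (pre @ x # ps)) (of_bool (check_counters (x # ps)))"
      unfolding q(2) using Cons.prems q(1)
        halts_with.halt[of "counting_ptm p" "counting_config q i (int (length pre)) (pre @ x # ps)"
          "{- 1..int L}" w "length ps + 1"] by simp
    show ?thesis
      using Cons.prems halts_with_det[OF st _ _ ha] by simp
  qed
qed

end

section \<open>Space bound and the run on a whole input\<close>

lemma valid_counters_heads_digit: "valid_counters ps \<Longrightarrow> \<forall>(d, e)\<in>set ps. e < 4"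
  by (induction ps rule: valid_counters.induct) auto

text \<open>The 8 comes from \<open>length_valid_counters\<close>, with both counter values at most
  \<open>n\<close>.\<close>

definition space_bound :: "nat \<Rightarrow> nat" where
  "space_bound n = floorlog 4 (8 * n)"

lemma length_le_space_bound:
  assumes "valid_counters ps" "count_value ps \<le> n" "heads_value ps \<le> n"
  shows "length ps \<le> space_bound n"
proof (cases "ps = []")
  case False
  then have "4 ^ length ps \<le> 4 * (count_value ps + heads_value ps)"
    using assms(1) by (intro length_valid_counters)
  also have "\<dots> \<le> 8 * n" using assms(2,3) by simp
  finally show ?thesis
    unfolding space_bound_def by (rule Suc_leD[OF floorlog_ge_SucI]) auto
qed simp

text \<open>Conditioning on the first toss gives exactly the combination produced by
  \<open>halts_with_branch\<close>.\<close>

lemma prob_binomial_Suc: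
  assumes "0 \<le> p" "p \<le> 1"
  shows "measure_pmf.prob (binomial_pmf (Suc n) p) {j. P j} =
    p * measure_pmf.prob (binomial_pmf n p) {j. P (Suc j)} +
    (1 - p) * measure_pmf.prob (binomial_pmf n p) {j. P j}"
proof -
  let ?f = "indicator {j. P j} :: nat \<Rightarrow> real"
  have "binomial_pmf (Suc n) p =
      bind_pmf (bernoulli_pmf p) (\<lambda>b. map_pmf ((+) (of_bool b)) (binomial_pmf n p))"
    using assms by (simp add: binomial_pmf_Suc map_pmf_def of_bool_def)
  then have "measure_pmf.expectation (binomial_pmf (Suc n) p) ?f =
      measure_pmf.expectation (bernoulli_pmf p)
        (\<lambda>b. measure_pmf.expectation (map_pmf ((+) (of_bool b)) (binomial_pmf n p)) ?f)"
    by (simp only: expectation_bind_pmf[of ?f, OF conjI[OF indicator_pos_le indicator_le_1]])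
  also have "\<dots> = measure_pmf.expectation (bernoulli_pmf p)
      (\<lambda>b. measure_pmf.prob (binomial_pmf n p) {j. P (of_bool b + j)})"
    by (simp add: vimage_def)
  finally show ?thesis using assms by (simp add: mult.commute)
qed

text \<open>Loop invariant with \<open>m\<close> letters read and \<open>r\<close> tosses to come;
  the head is at \<open>Suc m\<close> since position 0 is the end-marker. A letter costs one toss,
  at most \<open>L\<close> carry steps and \<open>L + 1\<close> return steps; the end costs one step
  and a scan of at most \<open>L + 1\<close>.\<close>

lemma counting_halts_ready:
  fixes w :: "unit list"
  assumes p: "0 \<le> p" "p \<le> 1"
  defines "L \<equiv> space_bound (length w)"
  assumes "m + r = length w" "valid_counters ps" "count_value ps = m" "heads_value ps \<le> m"
  shows "halts_with (counting_ptm p) w {- 1..int L} (r * (2 * L + 2) + (L + 2))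
    (counting_config 2 (Suc m) 0 ps)
    (measure_pmf.prob (binomial_pmf r p) {j. marked (length w) (heads_value ps + j)})"
  using assms(4-)
proof (induction r arbitrary: m ps)
  case 0
  have len: "length ps \<le> L"
    unfolding L_def using 0 by (intro length_le_space_bound) auto
  have "input_at w (Suc m) = Dollar" using 0 by (simp add: input_at_def)
  then have "step (counting_ptm p) w (counting_config 2 (Suc m) 0 ps) =
      return_pmf (counting_config 3 (Suc m) 0 ps)"
    using apply_keep[of 2 "Suc m" 0 ps 3 MStay MStay]
    by (simp add: step_counting_config counting_trans_def)
  moreover have "halts_with (counting_ptm p) w {- 1..int L} (length ps + 1)
      (counting_config 3 (Suc m) 0 ps) (of_bool (check_counters ps))"
    using counting_halts_check[of ps "[]" L p w "Suc m"] len valid_counters_heads_digit[OF 0(2)] by simp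
  ultimately have "halts_with (counting_ptm p) w {- 1..int L} (Suc (length ps + 1))
      (counting_config 2 (Suc m) 0 ps) (of_bool (check_counters ps))"
    by (intro halts_with_det) auto
  moreover have "of_bool (check_counters ps) =
      measure_pmf.prob (binomial_pmf 0 p) {j. marked (length w) (heads_value ps + j)}"
    using 0 by (simp add: binomial_pmf_0 p check_iff_marked indicator_def)
  ultimately show ?case using len by (auto intro: halts_with_mono)
next
  case (Suc r)
  define qs where "qs b = increment 1 (of_bool b) ps" for b
  define g where "g b = counting_config (if b then 7 else 5) (Suc (Suc m)) 0 ps" for b
  define a where "a b = measure_pmf.prob (binomial_pmf r p)
    {j. marked (length w) (heads_value ps + of_bool b + j)}" for b
  have qs: "valid_counters (qs b)" "count_value (qs b) = Suc m" "heads_value (qs b) = heads_value ps + of_bool b" for b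
    unfolding qs_def using increment_correct[of ps 1 "of_bool b"] Suc.prems by auto
  have len: "length (qs b) \<le> L" for b
    unfolding L_def using Suc.prems qs[of b] by (intro length_le_space_bound) auto
  have g: "halts_with (counting_ptm p) w {- 1..int L} (r * (2 * L + 2) + (L + 2) + 2 * L + 1) (g b) (a b)"
    for b
  proof -
    have "halts_with (counting_ptm p) w {- 1..int L} (r * (2 * L + 2) + (L + 2))
        (counting_config 2 (Suc (Suc m)) 0 (qs b)) (a b)"
      using Suc.IH[of "Suc m" "qs b"] Suc.prems qs[of b] by (simp add: a_def)
    then have "halts_with (counting_ptm p) w {- 1..int L}
        (r * (2 * L + 2) + (L + 2) + length (qs b) + length ([] @ qs b) + 1)
        (counting_config (4 + 1 + 2 * of_bool b) (Suc (Suc m)) (int (length ([] :: (nat \<times> nat) list)))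
          ([] @ ps)) (a b)"
      unfolding qs_def using len[of b, unfolded qs_def] valid_counters_heads_digit[OF Suc.prems(2)]
      by (intro counting_halts_increment) auto
    then have "halts_with (counting_ptm p) w {- 1..int L}
        (r * (2 * L + 2) + (L + 2) + length (qs b) + length (qs b) + 1) (g b) (a b)"
      by (cases b) (simp_all add: g_def)
    then show ?thesis using len[of b] by (auto intro: halts_with_mono)
  qed
  have "input_at w (Suc m) = Letter ()" using Suc.prems by (simp add: input_at_def)
  then have "step (counting_ptm p) w (counting_config 2 (Suc m) 0 ps) = map_pmf g (bernoulli_pmf p)"
    using apply_keep[of 2 "Suc m" 0 ps _ MRight MStay]
    by (simp add: step_counting_config counting_trans_def map_pmf_comp g_def[abs_def])
  then have "halts_with (counting_ptm p) w {- 1..int L}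
      (Suc (r * (2 * L + 2) + (L + 2) + 2 * L + 1)) (counting_config 2 (Suc m) 0 ps)
      (p * a True + (1 - p) * a False)"
    by (rule halts_with_branch)
      (use p g in \<open>auto simp: g_def inj_def counting_config_def split: if_splits\<close>)
  then show ?case using p by (simp add: prob_binomial_Suc a_def algebra_simps)
qed

text \<open>One step more than in \<open>counting_halts_ready\<close>, for leaving the left
  end-marker.\<close>

definition time_bound :: "nat \<Rightarrow> nat" where
  "time_bound n = n * (2 * space_bound n + 2) + (space_bound n + 3)"

lemma counting_halts_initial:
  assumes p: "0 \<le> p" "p \<le> 1"
  shows "halts_with (counting_ptm p) w {- 1..int (space_bound (length w))} (time_bound (length w))
    (initial (counting_ptm p))
    (measure_pmf.prob (binomial_pmf (length w) p) {h. marked (length w) h})"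
proof -
  have init: "initial (counting_ptm p) = counting_config 2 0 0 []"
    by (simp add: initial_def counting_config_def tape_def fun_eq_iff)
  have "step (counting_ptm p) w (counting_config 2 0 0 []) = return_pmf (counting_config 2 1 0 [])"
    using apply_keep[of 2 0 0 "[]" 2 MRight MStay]
    by (simp add: step_counting_config counting_trans_def input_at_def)
  moreover have "halts_with (counting_ptm p) w {- 1..int (space_bound (length w))}
      (length w * (2 * space_bound (length w) + 2) + (space_bound (length w) + 2))
      (counting_config 2 1 0 [])
      (measure_pmf.prob (binomial_pmf (length w) p) {h. marked (length w) h})"
    using counting_halts_ready[OF p, of 0 "length w" w "[]"] by simp
  ultimately have "halts_with (counting_ptm p) w {- 1..int (space_bound (length w))}
      (Suc (length w * (2 * space_bound (length w) + 2) + (space_bound (length w) + 2)))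
      (counting_config 2 0 0 [])
      (measure_pmf.prob (binomial_pmf (length w) p) {h. marked (length w) h})"
    by (intro halts_with_det) auto
  then show ?thesis
    unfolding init by (rule halts_with_mono) (simp add: time_bound_def)
qed

section \<open>Asymptotics of the time and space bounds\<close>

lemma space_bound_le: "2 \<le> n \<Longrightarrow> real (space_bound n) \<le> 5 * log 2 n"
proof -
  assume n: "2 \<le> n"
  then have l: "1 \<le> log 2 (real n)" by simp
  have "log 4 (8 * real n) \<le> log 2 (8 * real n)"
    using n by (simp add: log_def frac_le)
  also have "\<dots> = 3 + log 2 n"
    using n log_pow_cancel[of 2 3] by (simp add: log_mult)
  finally have "log 4 (8 * real n) \<le> 3 + log 2 n" .
  \<comment> \<open>\<open>floorlog\<close> is the floor of the logarithm plus one, which turns 3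
    into 4.\<close>
  then have "real (space_bound n) \<le> 4 + log 2 n"
    using n unfolding space_bound_def floorlog_def
    by simp linarith
  then show ?thesis using l by simp
qed

lemma space_bound_bigo: "(\<lambda>n. real (space_bound n + 2)) \<in> O(\<lambda>n. log 2 (real n))"
proof (rule bigoI)
  show "\<forall>\<^sub>F n in at_top. norm (real (space_bound n + 2)) \<le> 7 * norm (log 2 (real n))"
    using eventually_ge_at_top[of 2]
  proof eventually_elim
    case (elim n)
    then have "1 \<le> log 2 (real n)" by simp
    then show ?case using space_bound_le[OF elim] by simp
  qed
qed

lemma time_bound_bigo: "(\<lambda>n. real (time_bound n)) \<in> O(\<lambda>n. real n * log 2 (real n))"
proof (rule bigoI)
  show "\<forall>\<^sub>F n in at_top. norm (real (time_bound n)) \<le> 20 * norm (real n * log 2 (real n))"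
    using eventually_ge_at_top[of 2]
  proof eventually_elim
    case (elim n)
    then have l: "1 \<le> log 2 (real n)" by simp
    have "real (time_bound n) \<le> real n * (2 * space_bound n + 2) + real n * (space_bound n + 3)"
      using elim mult_right_mono[of 1 "real n" "real (space_bound n) + 3"]
      by (simp add: time_bound_def algebra_simps)
    also have "\<dots> = real n * (3 * space_bound n + 5)" by (simp add: algebra_simps)
    \<comment> \<open>3 * 5 + 5 = 20, as the logarithm is at least 1.\<close>
    also have "\<dots> \<le> real n * (20 * log 2 n)"
      using l space_bound_le[OF elim] by (intro mult_left_mono) auto
    finally show ?case using l by simp
  qed
qed

section \<open>Uncountably many languages\<close>

lemma uncountable_UNIV_nat_set: "uncountable (UNIV :: nat set set)"
proof
  assume "countable (UNIV :: nat set set)"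
  then have "range (from_nat_into UNIV) = (UNIV :: nat set set)"
    by (intro range_from_nat_into) auto
  then show False using Cantors_theorem[of "UNIV :: nat set"] by auto
qed

theorem theorem5:
  "uncountable {L :: unit list set.
     \<exists>M :: (nat, nat, unit) ptm.
       is_ptm M \<and> one_way M \<and> recognizes_bounded_error M L \<and>
       runs_in_time M (\<lambda>n. real n * log 2 (real n)) \<and>
       runs_in_space M (\<lambda>n. log 2 (real n))}" (is "uncountable ?C")
proof
  assume "countable ?C"
  \<comment> \<open>The shift by 3 keeps the first three digits zero, so every set \<open>A\<close>
    yields a coin bias.\<close>
  define lang :: "nat set \<Rightarrow> unit list set" where
    "lang A = {w. \<exists>k\<in>A. length w = repunit (k + 3)}" for A
  have lang: "lang A \<in> ?C" for A
  proof -
    define I where "I = (\<lambda>k. k + 3) ` A"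
    have I: "I \<inter> {..<3} = {}" by (auto simp: I_def)
    define p where "p = 15 * expansion I"
    have p: "0 \<le> p" "p \<le> 1"
      using expansion_bounds[of I] expansion_le_of_small[OF I] by (auto simp: p_def)
    have acc: "accept_prob (counting_ptm p) w =
        measure_pmf.prob (binomial_pmf (length w) p) {h. marked (length w) h}" for w
      by (rule accept_prob_eq[OF counting_halts_initial[OF p]])
    have "accept_prob (counting_ptm p) w \<ge> 1 - 4 / 9" if "w \<in> lang A" for w
    proof -
      from that obtain k where "length w = repunit k" "k \<in> I" by (auto simp: lang_def I_def)
      then show ?thesis unfolding acc using prob_marked(1)[OF I, of k] by (simp add: p_def)
    qed
    moreover have "accept_prob (counting_ptm p) w \<le> 4 / 9" if "w \<notin> lang A" for w
    proof (cases "\<exists>k. length w = repunit k")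
      case True
      then obtain k where k: "length w = repunit k" by blast
      then have "k \<notin> I" using that by (auto simp: lang_def I_def)
      then show ?thesis unfolding acc using prob_marked(2)[OF I, of k] k by (simp add: p_def)
    next
      case False
      \<comment> \<open>At other lengths no heads count is marked, so the word is accepted with
        probability 0.\<close>
      then have "{h. marked (length w) h} = {}" by (auto simp: marked_def)
      then show ?thesis by (simp add: acc)
    qed
    ultimately have "recognizes_bounded_error (counting_ptm p) (lang A)"
      unfolding recognizes_bounded_error_def by (intro exI[of _ "4 / 9"]) auto
    moreover have "runs_in_time (counting_ptm p) (\<lambda>n. real n * log 2 (real n))"
      unfolding runs_in_time_def
      using time_bound_bigo time_on_le[OF counting_halts_initial[OF p]]
      by (intro exI[of _ time_bound] conjI allI)
    \<comment> \<open>The interval from -1 to \<open>space_bound (length w)\<close> has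
      \<open>space_bound (length w) + 2\<close> cells.\<close>
    moreover have "space_on (counting_ptm p) w \<le> enat (space_bound (length w) + 2)" for w
      using space_on_le[OF counting_halts_initial[OF p], of w] by (simp add: nat_add_distrib add.commute)
    then have "runs_in_space (counting_ptm p) (\<lambda>n. log 2 (real n))"
      unfolding runs_in_space_def using space_bound_bigo
      by (intro exI[of _ "\<lambda>n. space_bound n + 2"] conjI allI)
    ultimately show ?thesis
      using is_ptm_counting_ptm one_way_counting_ptm
      by (intro CollectI exI[of _ "counting_ptm p"] conjI)
  qed
  have "countable (range lang)"
    by (rule countable_subset[OF image_subsetI \<open>countable ?C\<close>]) (rule lang)
  moreover have "inj lang"
  proof (rule injI)
    fix A B
    assume eq: "lang A = lang B"
    \<comment> \<open>One word per \<open>k\<close> decides membership, since different exponents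
      give different repunits.\<close>
    have mem: "replicate (repunit (k + 3)) () \<in> lang X \<longleftrightarrow> k \<in> X" for k X
      unfolding lang_def mem_Collect_eq length_replicate repunit_inj by simp
    show "A = B" by (rule set_eqI) (simp only: eq flip: mem)
  qed
  ultimately show False
    using uncountable_UNIV_nat_set countable_image_inj_on[of lang UNIV] by simp
qed

end
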